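(* Let $\mu$ be a continuous probability distribution on $\mathbb{R}^d$ that is a doubling measure of dimension $d_o\ge2$ with respect to a subset $\mathcal{X}\subseteq\mathbb{R}^d$. Pick any $q\in\mathcal{X}$, draw $x_1,\ldots,x_n$ independently at random from $\mu$, let $0<\delta<1/2$ and $k\ge1$. Then with probability at least $1-3\delta$ over the choice of the $x_i$, for all $2\le m\le n$, $$\Phi_{k,m}(q,\{x_1,\ldots,x_n\})\ \le\ 6\left(\frac8m\max\left(k,\ln\frac1\delta\right)\right)^{1/d_o}.$$
   Context: $\mu$ is a doubling measure of dimension $d_o$ with respect to $\mathcal{X}$ if $\mu(B(x,2r))\le 2^{d_o}\,\mu(B(x,r))$ for all $x\in\mathcal{X}$ and all $r>0$, where $B(x,r)$ is the closed Euclidean ball of radius $r$ centered at $x$. $x_{(1)},\ldots,x_{(n)}$ orders the data by increasing Euclidean distance from $q$, and $$\Phi_{k,m}(q,\{x_1,\ldots,x_n\})=\frac1m\sum_{i=k+1}^m\frac{(\|q-x_{(1)}\|+\cdots+\|q-x_{(k)}\|)/k}{\|q-x_{(i)}\|}.$$ *)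

theory Defs
  imports "HOL-Probability.Probability"
begin

text \<open>A continuous measure is one without point masses; it need not have a Lebesgue density, so
  distributions concentrated on lower-dimensional subsets are allowed.\<close>

definition continuous_measure :: "'a measure \<Rightarrow> bool" where
  "continuous_measure \<mu> \<longleftrightarrow> (\<forall>x. emeasure \<mu> {x} = 0)"

definition doubling_measure :: "real \<Rightarrow> 'a::metric_space set \<Rightarrow> 'a measure \<Rightarrow> bool" where
  "doubling_measure d\<^sub>o X \<mu> \<longleftrightarrow>
     (\<forall>x\<in>X. \<forall>r>0. emeasure \<mu> (cball x (2 * r)) \<le> ennreal (2 powr d\<^sub>o) * emeasure \<mu> (cball x r))"

text \<open>\<open>nearest q xs i\<close> is $x_{(i)}$, with \<open>i\<close> counted from 1. The data are kept as a list, so repeated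
  points keep their multiplicity. The order chosen among points at equal distance from \<open>q\<close> does
  not affect the distances \<open>norm (q - nearest q xs i)\<close>.\<close>

definition nearest :: "'a::metric_space \<Rightarrow> 'a list \<Rightarrow> nat \<Rightarrow> 'a" where
  "nearest q xs i = sort_key (dist q) xs ! (i - 1)"

text \<open>Only meaningful for \<open>k \<ge> 1\<close> and \<open>1 \<le> m \<le> length xs\<close>; the outer sum is empty (value 0) if
  \<open>m \<le> k\<close>, in particular whenever \<open>k\<close> exceeds the number of data points. A term with \<open>nearest q xs i = q\<close>
  counts as 0 by the convention on division; under a continuous measure this is a null event.\<close>

definition Phi :: "nat \<Rightarrow> nat \<Rightarrow> 'a::real_normed_vector \<Rightarrow> 'a list \<Rightarrow> real" where
  "Phi k m q xs =
     1 / real m * (\<Sum>i = k+1..m.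
        ((\<Sum>j = 1..k. norm (q - nearest q xs j)) / real k) / norm (q - nearest q xs i))"

end

theory Submission
  imports Defs
begin

text \<open>Put $K = \max(k, \ln(1/\delta))$. If $n \le 16K$ the bound holds surely, because every summand is
  at most 1. Otherwise let $r$ be a radius at which the mass of the ball around $q$ crosses $4K/n$, and
  $r_i$ one at which it crosses $i/(4n)$. By exponential Markov bounds, with probability $1 - 3\delta$
  at least $k$ points lie in the closed ball of radius $r$ and, for every $i > 16K$, fewer than $i$
  points lie in the open ball of radius $r_i$. Then $\|q - x_{(k)}\| / \|q - x_{(i)}\| \le r / r_i$, which
  doubling bounds by $2 (16K/i)^{1/d_o}$; for $i \le 16K$ this bound is trivial. Summing
  $i^{-1/d_o}$ over $i \le m$ costs a factor $1/(1 - 1/d_o) \le 2$, and $4 \cdot 2^{1/d_o} \le 6$.\<close>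

section \<open>Order statistics of the distances, via counting\<close>

text \<open>In a sorted list the entries satisfying a downward closed \<open>P\<close> form an
  initial segment.\<close>

lemma sorted_nth_iff_less_length_filter:
  fixes ys :: "'a::linorder list"
  assumes "sorted ys" and "j < length ys" and "\<And>a b. P b \<Longrightarrow> a \<le> b \<Longrightarrow> P a"
  shows "P (ys ! j) \<longleftrightarrow> j < length (filter P ys)"
  using assms(1,2)
proof (induction ys arbitrary: j)
  case (Cons y ys)
  show ?case
  proof (cases "P y")
    case True
    then show ?thesis using Cons by (cases j) auto
  next
    case False
    then have no: "\<not> P z" if "z \<in> set (y # ys)" for z
      using that Cons.prems(1) assms(3) by auto
    then have "filter P (y # ys) = []" by (auto simp: filter_empty_conv)
    then show ?thesis using no[OF nth_mem[OF Cons.prems(2)]] by (metis list.size(3) not_less_zero)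
  qed
qed simp

lemma dist_nearest_mono:
  assumes "1 \<le> i" "i \<le> j" "j \<le> length xs"
  shows "dist q (nearest q xs i) \<le> dist q (nearest q xs j)"
  using sorted_nth_mono[OF sorted_sort_key[of "dist q" xs], of "i - 1" "j - 1"] assms
  by (simp add: nearest_def)

text \<open>Turns order statistics into counts of sample points, since sorting preserves the number
  of entries satisfying \<open>P\<close>. A general downward closed \<open>P\<close> covers both
  closed balls (\<open>\<le> r\<close>) and open balls (\<open>< r\<close>).\<close>

lemma dist_nearest_iff:
  assumes "1 \<le> j" "j \<le> n" and mono: "\<And>a b. P b \<Longrightarrow> a \<le> b \<Longrightarrow> P a"
  shows "P (dist q (nearest q (map x [1..<n+1]) j)) \<longleftrightarrow> j \<le> card {i\<in>{1..n}. P (dist q (x i))}"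
proof -
  let ?xs = "map x [1..<n+1]"
  let ?ys = "map (dist q) (sort_key (dist q) ?xs)"
  have "mset (filter P ?ys) = mset (filter P (map (dist q) ?xs))"
    by (simp add: mset_filter multiset.map_comp o_def del: upt_Suc)
  then have "length (filter P ?ys) = length (filter P (map (dist q) ?xs))"
    by (rule mset_eq_length)
  also have "\<dots> = length (filter (\<lambda>i. P (dist q (x i))) [1..<n+1])"
    by (simp add: filter_map o_def del: upt_Suc)
  also have "\<dots> = card (set (filter (\<lambda>i. P (dist q (x i))) [1..<n+1]))"
    by (rule distinct_card[symmetric]) simp
  also have "set (filter (\<lambda>i. P (dist q (x i))) [1..<n+1]) = {i\<in>{1..n}. P (dist q (x i))}"
    by auto
  finally have len: "length (filter P ?ys) = card {i\<in>{1..n}. P (dist q (x i))}" .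
  have "P (?ys ! (j - 1)) \<longleftrightarrow> j - 1 < length (filter P ?ys)"
    by (rule sorted_nth_iff_less_length_filter) (use assms in \<open>auto simp del: upt_Suc\<close>)
  moreover have "?ys ! (j - 1) = dist q (nearest q ?xs j)"
    using assms by (simp add: nearest_def del: upt_Suc)
  ultimately show ?thesis using len assms(1) by auto
qed

text \<open>No measurability of sorting is needed: a sublevel set of the \<open>j\<close>-th
  distance is a finite union, over index sets of size at least \<open>j\<close>, of finite
  intersections of events in one coordinate.\<close>

lemma measurable_dist_nearest:
  fixes q :: "'a::{metric_space, second_countable_topology}"
  assumes sets: "sets \<mu> = sets borel" and j: "1 \<le> j" "j \<le> n"
  shows "(\<lambda>x. dist q (nearest q (map x [1..<n+1]) j)) \<in> borel_measurable (\<Pi>\<^sub>M i\<in>{1..n}. \<mu>)"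
proof (rule borel_measurableI_le)
  fix t :: real
  let ?M = "\<Pi>\<^sub>M i\<in>{1..n}. \<mu>"
  have comp: "(\<lambda>x. dist q (x i)) \<in> borel_measurable ?M" if "i \<in> {1..n}" for i
  proof -
    have "(\<lambda>x. x i) \<in> measurable ?M \<mu>" using that by simp
    then have [measurable]: "(\<lambda>x. x i) \<in> measurable ?M borel"
      using measurable_cong_sets[OF refl sets] by blast
    show ?thesis by measurable
  qed
  have "{x \<in> space ?M. dist q (nearest q (map x [1..<n+1]) j) \<le> t}
      = {x \<in> space ?M. \<exists>S\<in>{S. S \<subseteq> {1..n} \<and> j \<le> card S}. \<forall>i\<in>S. dist q (x i) \<le> t}"
  proof (intro Collect_cong conj_cong refl)
    fix x :: "nat \<Rightarrow> 'a"
    show "dist q (nearest q (map x [1..<n+1]) j) \<le> t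
      \<longleftrightarrow> (\<exists>S\<in>{S. S \<subseteq> {1..n} \<and> j \<le> card S}. \<forall>i\<in>S. dist q (x i) \<le> t)"
      (is "?L \<longleftrightarrow> ?R")
    proof -
      let ?C = "{i \<in> {1..n}. dist q (x i) \<le> t}"
      have "?L \<longleftrightarrow> j \<le> card ?C"
        by (rule dist_nearest_iff[OF j]) simp
      moreover have "j \<le> card ?C \<Longrightarrow> ?R"
        by (intro bexI[of _ ?C]) auto
      moreover have "j \<le> card ?C" if S: "S \<subseteq> {1..n}" "j \<le> card S" "\<forall>i\<in>S. dist q (x i) \<le> t" for S
        using that card_mono[of ?C S] by fastforce
      ultimately show "?L \<longleftrightarrow> ?R" by blast
    qed
  qed
  also have "\<dots> \<in> sets ?M"
  proof (intro sets.sets_Collect_finite_Ex sets.sets_Collect_finite_All')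
    fix S i assume "S \<in> {S. S \<subseteq> {1..n} \<and> j \<le> card S}" "i \<in> S"
    then have "i \<in> {1..n}" by auto
    from comp[OF this] show "{x \<in> space ?M. dist q (x i) \<le> t} \<in> sets ?M" by measurable
  qed (use j in \<open>auto dest: finite_subset\<close>)
  finally show "{x \<in> space ?M. dist q (nearest q (map x [1..<n+1]) j) \<le> t} \<in> sets ?M" .
qed

lemma measurable_Phi:
  fixes q :: "'a::{real_normed_vector, second_countable_topology}"
  assumes sets: "sets \<mu> = sets borel" and m: "m \<le> n"
  shows "(\<lambda>x. Phi k m q (map x [1..<n+1])) \<in> borel_measurable (\<Pi>\<^sub>M i\<in>{1..n}. \<mu>)"
proof -
  \<comment> \<open>Inside the outer sum \<open>j \<le> k < i \<le> m \<le> n\<close>, so only order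
    statistics of index at most \<open>n\<close> occur; for \<open>k \<ge> m\<close> that sum is
    empty.\<close>
  show ?thesis
    unfolding Phi_def dist_norm[symmetric]
    by (intro borel_measurable_times borel_measurable_sum borel_measurable_divide
        measurable_dist_nearest[OF sets] borel_measurable_const) (use m in auto)
qed

section \<open>Exponential moments and tails of the number of sample points in a set\<close>

text \<open>The generating function of a binomial count: the power is a product of independent
  factors, \<open>c\<close> or 1, each with mean
  \<open>1 + (c - 1) * measure \<mu> A\<close>.\<close>

lemma integral_power_count:
  fixes c :: real
  assumes "prob_space \<mu>" and A: "A \<in> sets \<mu>" and "finite I"
  shows "integrable (\<Pi>\<^sub>M i\<in>I. \<mu>) (\<lambda>x. c ^ card {i\<in>I. x i \<in> A})" (is ?int)
    and "(\<integral>x. c ^ card {i\<in>I. x i \<in> A} \<partial>(\<Pi>\<^sub>M i\<in>I. \<mu>)) = (1 + (c - 1) * measure \<mu> A) ^ card I" (is ?eq)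
proof -
  interpret \<mu>: prob_space \<mu> by fact
  interpret product_prob_space "\<lambda>_. \<mu>" I by unfold_locales
  let ?f = "\<lambda>y. 1 + (c - 1) * indicator A y :: real"
  have prod: "(\<Prod>i\<in>I. ?f (x i)) = c ^ card {i\<in>I. x i \<in> A}" for x :: "'b \<Rightarrow> 'a"
  proof -
    have "(\<Prod>i\<in>I. ?f (x i)) = (\<Prod>i\<in>I. if x i \<in> A then c else 1)"
      by (rule prod.cong) auto
    also have "\<dots> = c ^ card {i\<in>I. x i \<in> A}"
      using \<open>finite I\<close> by (simp add: prod.If_cases Int_def)
    finally show ?thesis .
  qed
  have ind: "integrable \<mu> (indicator A :: 'a \<Rightarrow> real)"
    using A by (simp add: \<mu>.emeasure_eq_measure)
  have f: "integrable \<mu> ?f"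
    using ind by simp
  show ?int using product_integrable_prod[of I "\<lambda>_. ?f"] f \<open>finite I\<close> prod by simp
  have "integral\<^sup>L \<mu> ?f = 1 + (c - 1) * measure \<mu> A"
    using A ind by (subst Bochner_Integration.integral_add) (auto simp: \<mu>.prob_space)
  then show ?eq using product_integral_prod[of I "\<lambda>_. ?f"] f \<open>finite I\<close> prod by simp
qed

lemma measurable_card_count:
  assumes "A \<in> sets \<mu>" "finite I"
  shows "(\<lambda>x. card {i\<in>I. x i \<in> A}) \<in> measurable (\<Pi>\<^sub>M i\<in>I. \<mu>) (count_space UNIV)"
proof -
  have "card {i\<in>I. x i \<in> A} = (\<Sum>i\<in>I. if x i \<in> A then 1 else 0)" for x
    using \<open>finite I\<close> by (simp add: sum.If_cases Int_def)
  moreover have "(\<lambda>x. \<Sum>i\<in>I. if x i \<in> A then 1 else 0 :: nat) \<in> measurable (\<Pi>\<^sub>M i\<in>I. \<mu>) (count_space UNIV)"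
    using assms by measurable
  ultimately show ?thesis by simp
qed

text \<open>Markov's inequality for 4 to the power of the count, whose mean is at most
  \<open>exp (3 * (real i / 4))\<close>. As \<open>ln 2 \<ge> 2/3\<close>, dividing by
  \<open>4 ^ i\<close> leaves at most 3/4 - 4/3 = -7/12 as the coefficient of \<open>i\<close> in
  the exponent.\<close>

lemma count_upper_tail:
  assumes "prob_space \<mu>" and A: "A \<in> sets \<mu>"
    and small: "real n * measure \<mu> A \<le> real i / 4"
  shows "measure (\<Pi>\<^sub>M i\<in>{1..n}. \<mu>) {x\<in>space (\<Pi>\<^sub>M i\<in>{1..n}. \<mu>). i \<le> card {j\<in>{1..n}. x j \<in> A}}
    \<le> exp (- 7 / 12 * real i)"
proof -
  let ?M = "\<Pi>\<^sub>M i\<in>{1..n}. \<mu>"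
  let ?u = "\<lambda>x. 4 ^ card {j\<in>{1..n}. x j \<in> A} :: real"
  have "measure ?M {x\<in>space ?M. i \<le> card {j\<in>{1..n}. x j \<in> A}} = measure ?M {x\<in>space ?M. ?u x \<ge> 4 ^ i}"
    by simp
  also have "\<dots> \<le> (\<integral>x. ?u x \<partial>?M) / 4 ^ i"
    by (rule integral_Markov_inequality_measure[where A="{}"])
       (use integral_power_count(1)[OF assms(1,2), of "{1..n}" 4] in simp_all)
  also have "(\<integral>x. ?u x \<partial>?M) = (1 + 3 * measure \<mu> A) ^ n"
    using integral_power_count(2)[OF assms(1,2), of "{1..n}" 4] by simp
  also have "\<dots> \<le> exp (3 * measure \<mu> A) ^ n"
    by (intro power_mono) auto
  also have "\<dots> = exp (3 * (real n * measure \<mu> A))"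
    by (simp add: exp_of_nat_mult[symmetric] algebra_simps)
  also have "\<dots> \<le> exp (3 * (real i / 4))"
    using small by simp
  also have "\<dots> / 4 ^ i = exp (3 * (real i / 4) - 2 * ln 2 * real i)"
  proof -
    have "(4::real) ^ i = exp (2 * ln 2) ^ i"
      by (simp add: exp_double)
    then show ?thesis by (simp add: exp_diff exp_of_nat_mult[symmetric] algebra_simps)
  qed
  also have "\<dots> \<le> exp (- 7 / 12 * real i)"
    using mult_right_mono[OF ln2_ge_two_thirds, of "real i"] by simp
  finally show ?thesis by (simp add: divide_right_mono)
qed

text \<open>A base below 1 turns a small count into a large power. The mean of that power is at most
  \<open>exp (- 2 * K)\<close>, and Markov's factor \<open>2 ^ k \<le> exp K\<close> uses up half of
  the exponent.\<close>

lemma count_lower_tail: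
  assumes "prob_space \<mu>" and A: "A \<in> sets \<mu>" and "real k \<le> K"
    and large: "4 * K \<le> real n * measure \<mu> A"
  shows "measure (\<Pi>\<^sub>M i\<in>{1..n}. \<mu>) {x\<in>space (\<Pi>\<^sub>M i\<in>{1..n}. \<mu>). card {j\<in>{1..n}. x j \<in> A} < k}
    \<le> exp (- K)"
proof -
  let ?M = "\<Pi>\<^sub>M i\<in>{1..n}. \<mu>"
  let ?u = "\<lambda>x. (1/2) ^ card {j\<in>{1..n}. x j \<in> A} :: real"
  interpret prob_space ?M using assms(1) by (intro prob_space_PiM)
  have m: "?u \<in> borel_measurable ?M"
    using integral_power_count(1)[OF assms(1,2), of "{1..n}" "1/2"] by auto
  have "measure ?M {x\<in>space ?M. card {j\<in>{1..n}. x j \<in> A} < k}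
      \<le> measure ?M {x\<in>space ?M. ?u x \<ge> (1/2) ^ k}"
  proof (rule finite_measure_mono)
    show "{x \<in> space ?M. (1/2) ^ k \<le> ?u x} \<in> sets ?M" using m by measurable
  qed (auto intro!: power_decreasing)
  also have "\<dots> \<le> (\<integral>x. ?u x \<partial>?M) / (1/2) ^ k"
    by (rule integral_Markov_inequality_measure[where A="{}"])
       (use integral_power_count(1)[OF assms(1,2), of "{1..n}" "1/2"] in simp_all)
  also have "(\<integral>x. ?u x \<partial>?M) = (1 - measure \<mu> A / 2) ^ n"
    using integral_power_count(2)[OF assms(1,2), of "{1..n}" "1/2"] by simp
  also have "\<dots> \<le> exp (- measure \<mu> A / 2) ^ n"
  proof (rule power_mono)
    show "1 - measure \<mu> A / 2 \<le> exp (- measure \<mu> A / 2)"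
      using exp_ge_add_one_self[of "- measure \<mu> A / 2"] by simp
    show "0 \<le> 1 - measure \<mu> A / 2"
      using prob_space.prob_le_1[OF assms(1), of A] by simp
  qed
  also have "\<dots> = exp (- (real n * measure \<mu> A) / 2)"
    by (simp add: exp_of_nat_mult[symmetric] algebra_simps)
  also have "\<dots> \<le> exp (- 2 * K)"
    using large by simp
  also have "exp (- 2 * K) / (1/2) ^ k = exp (- 2 * K) * 2 ^ k"
    by (simp add: power_one_over divide_simps)
  also have "(2::real) ^ k \<le> exp 1 ^ k"
    using exp_ge_add_one_self[of 1] by (intro power_mono) auto
  also have "exp 1 ^ k = exp (real k)"
    by (simp add: exp_of_nat_mult[symmetric])
  also have "\<dots> \<le> exp K" using assms(3) by simp
  also have "exp (- 2 * K) * exp K = exp (- K)"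
    by (simp add: exp_add[symmetric])
  finally show ?thesis by (simp add: divide_right_mono mult_left_mono)
qed

section \<open>Quantile radii\<close>

text \<open>Spheres around \<open>q\<close> may have positive mass, so a ball of mass exactly \<open>p\<close> need not exist; the closed
  and the open ball bracket it.\<close>

lemma exists_quantile_radius:
  fixes q :: "'a::{metric_space, second_countable_topology}"
  assumes "prob_space \<mu>" and sets: "sets \<mu> = sets borel" and "0 < p" "p < 1"
  obtains r where "p \<le> measure \<mu> (cball q r)" and "measure \<mu> (ball q r) \<le> p"
proof -
  interpret prob_space \<mu> by fact
  have m: "dist q \<in> borel_measurable \<mu>"
    unfolding measurable_cong_sets[OF sets refl] by measurable
  have space: "space \<mu> = UNIV" using sets_eq_imp_space_eq[OF sets] by simp
  let ?D = "distr \<mu> borel (dist q)"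
  interpret D: cdf_distribution ?D
    using m by (simp add: cdf_distribution_def)
  have cball: "measure \<mu> (cball q r) = cdf ?D r" for r
    using m space by (simp add: cdf_def2 measure_distr cball_def vimage_def)
  \<comment> \<open>\<open>D.I\<close> is the generalized inverse of the cdf, so \<open>r\<close> is
    the least radius whose closed ball has mass at least \<open>p\<close>.\<close>
  define r where "r = D.I p"
  have iff: "p \<le> cdf ?D s \<longleftrightarrow> r \<le> s" for s
    unfolding r_def by (rule D.pseudoinverse[OF assms(3,4)])
  \<comment> \<open>The mass of the open half-line is the left limit of the cdf at \<open>r\<close>,
    and the cdf is below \<open>p\<close> at every \<open>s < r\<close>.\<close>
  have "measure ?D {..<r} \<le> p"
  proof (rule tendsto_upperbound[OF D.finite_borel_measure_M[THEN finite_borel_measure.cdf_at_left]])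
    show "eventually (\<lambda>s. cdf ?D s \<le> p) (at_left r)"
      unfolding eventually_at_filter using iff by (auto intro!: always_eventually simp: not_le) (metis less_eq_real_def not_le)
  qed simp
  moreover have "measure ?D {..<r} = measure \<mu> (ball q r)"
    using m space by (simp add: measure_distr ball_def vimage_def)
  ultimately show ?thesis using that[of r] cball iff by simp
qed

section \<open>Deterministic bound on \<open>Phi\<close>\<close>

text \<open>The right side is the integral of \<open>x powr (- s)\<close> from 0 to
  \<open>m\<close>; the induction compares each new summand with the increment of the
  antiderivative.\<close>

lemma sum_powr_minus_le:
  fixes s :: real
  assumes "0 \<le> s" "s < 1"
  shows "(\<Sum>i = 1..m. real i powr (- s)) \<le> real m powr (1 - s) / (1 - s)"
proof (induction m)
  case (Suc m)
  let ?a = "real m" and ?b = "real m + 1"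
  \<comment> \<open>weighted AM-GM stands in for the integral comparison of the new summand\<close>
  have "?a powr (1 - s) * ?b powr s \<le> (1 - s) * ?a + s * ?b"
    using Youngs_inequality_0[of "1 - s" s ?a ?b] assms by (cases "m = 0") auto
  then have "?a powr (1 - s) * ?b powr s * ?b powr (- s) \<le> ((1 - s) * ?a + s * ?b) * ?b powr (- s)"
    by (rule mult_right_mono) simp
  also have "?a powr (1 - s) * ?b powr s * ?b powr (- s) = ?a powr (1 - s)"
    by (simp add: mult.assoc flip: powr_add)
  also have "((1 - s) * ?a + s * ?b) * ?b powr (- s) = ?b powr 1 * ?b powr (- s) - (1 - s) * ?b powr (- s)"
    by (simp add: algebra_simps)
  also have "?b powr 1 * ?b powr (- s) = ?b powr (1 - s)"
    by (simp only: powr_add[symmetric]) simp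
  finally have step: "?a powr (1 - s) + (1 - s) * ?b powr (- s) \<le> ?b powr (1 - s)"
    by simp
  have "(\<Sum>i = 1..Suc m. real i powr (- s)) \<le> ?a powr (1 - s) / (1 - s) + ?b powr (- s)"
    using Suc by (simp add: add.commute)
  also have "\<dots> = (?a powr (1 - s) + (1 - s) * ?b powr (- s)) / (1 - s)"
    using assms by (simp add: field_simps)
  also have "\<dots> \<le> ?b powr (1 - s) / (1 - s)"
    using step assms by (intro divide_right_mono) auto
  finally show ?case by (simp add: add.commute)
qed simp

text \<open>The mean of the \<open>k\<close> smallest distances is at most the \<open>k\<close>-th,
  so each summand is at most a ratio of two order statistics. The constant 4 is the 2 in
  \<open>ratio\<close> times the bound 2 on \<open>1 / (1 - s)\<close>.\<close>

lemma Phi_le: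
  assumes "1 \<le> k" "1 \<le> m" "m \<le> length xs" and s: "0 \<le> s" "s \<le> 1/2" and "0 \<le> C"
    and ratio: "\<And>i. k < i \<Longrightarrow> i \<le> m \<Longrightarrow> C < real i \<Longrightarrow>
      dist q (nearest q xs k) / dist q (nearest q xs i) \<le> 2 * (C / real i) powr s"
  shows "Phi k m q xs \<le> 4 * (C / real m) powr s"
proof -
  let ?D = "\<lambda>i. dist q (nearest q xs i)"
  have term_le: "((\<Sum>j = 1..k. ?D j) / real k) / ?D i \<le> 2 * C powr s * real i powr (- s)"
    if i: "i \<in> {k+1..m}" for i
  proof -
    have "(\<Sum>j = 1..k. ?D j) \<le> (\<Sum>j = 1..k. ?D k)"
      by (intro sum_mono dist_nearest_mono) (use i assms in auto)
    then have "(\<Sum>j = 1..k. ?D j) / real k \<le> ?D k"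
      using \<open>1 \<le> k\<close> by (simp add: field_simps)
    then have "((\<Sum>j = 1..k. ?D j) / real k) / ?D i \<le> ?D k / ?D i"
      by (intro divide_right_mono) auto
    also have "\<dots> \<le> 2 * (C / real i) powr s"
    proof (cases "C < real i")
      case True
      then show ?thesis using ratio i by auto
    next
      case False
      have "?D k \<le> ?D i" by (rule dist_nearest_mono) (use i assms in auto)
      \<comment> \<open>This includes \<open>?D i = 0\<close>, where the quotient is 0.\<close>
      then have "?D k / ?D i \<le> 1" by (simp add: divide_le_eq_1)
      also have "1 \<le> (C / real i) powr s"
        using False i s by (intro ge_one_powr_ge_zero) (auto simp: field_simps)
      also have "(C / real i) powr s \<le> 2 * (C / real i) powr s" by simp
      finally show ?thesis .
    qed
    also have "\<dots> = 2 * C powr s * real i powr (- s)"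
      using \<open>0 \<le> C\<close> by (simp add: powr_divide powr_minus field_simps)
    finally show ?thesis .
  qed
  have "(\<Sum>i = k+1..m. ((\<Sum>j = 1..k. ?D j) / real k) / ?D i)
      \<le> (\<Sum>i = k+1..m. 2 * C powr s * real i powr (- s))"
    by (rule sum_mono) (rule term_le)
  also have "\<dots> \<le> (\<Sum>i = 1..m. 2 * C powr s * real i powr (- s))"
    by (rule sum_mono2) auto
  also have "\<dots> = 2 * C powr s * (\<Sum>i = 1..m. real i powr (- s))"
    by (simp add: sum_distrib_left)
  also have "\<dots> \<le> 2 * C powr s * (real m powr (1 - s) / (1 - s))"
    using sum_powr_minus_le[of s m] s by (intro mult_left_mono) auto
  also have "\<dots> \<le> 2 * C powr s * (real m powr (1 - s) * 2)"
  proof (intro mult_left_mono)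
    have "1 / (1 - s) \<le> 2" using s by (simp add: field_simps)
    from mult_left_mono[OF this, of "real m powr (1 - s)"]
    show "real m powr (1 - s) / (1 - s) \<le> real m powr (1 - s) * 2" by simp
  qed simp
  finally have "Phi k m q xs \<le> 1 / real m * (2 * C powr s * (real m powr (1 - s) * 2))"
    unfolding Phi_def dist_norm[symmetric] by (intro mult_left_mono) auto
  also have "\<dots> = 4 * (C / real m) powr s"
    using \<open>1 \<le> m\<close> \<open>0 \<le> C\<close> by (simp add: powr_divide powr_diff field_simps)
  finally show ?thesis .
qed

section \<open>Doubling and ratios of quantile radii\<close>

lemma doubling_measure_iterate:
  assumes "finite_measure \<mu>" "doubling_measure d X \<mu>" "q \<in> X" "0 < s"
  shows "measure \<mu> (cball q (2 ^ t * s)) \<le> (2 powr d) ^ t * measure \<mu> (cball q s)"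
proof (induction t)
  case (Suc t)
  interpret finite_measure \<mu> by fact
  have "emeasure \<mu> (cball q (2 * (2 ^ t * s))) \<le> ennreal (2 powr d) * emeasure \<mu> (cball q (2 ^ t * s))"
    using assms by (auto simp: doubling_measure_def)
  then have "measure \<mu> (cball q (2 * (2 ^ t * s))) \<le> 2 powr d * measure \<mu> (cball q (2 ^ t * s))"
    by (simp add: emeasure_eq_measure ennreal_mult'[symmetric])
  also have "\<dots> \<le> 2 powr d * ((2 powr d) ^ t * measure \<mu> (cball q s))"
    by (intro mult_left_mono Suc.IH) simp
  finally show ?case by (simp add: mult.assoc)
qed simp

text \<open>Halve \<open>r'\<close> until it drops below \<open>r\<close>: the resulting closed ball
  lies in the open ball of mass at most \<open>p\<close>, while doubling it back to
  \<open>r'\<close> gains at most a factor \<open>2 powr d\<close> per step. Rounding to a power of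
  2 costs the factor 2.\<close>

lemma doubling_quantile_ratio:
  assumes "prob_space \<mu>" and sets: "sets \<mu> = sets borel" and "continuous_measure \<mu>"
    and "doubling_measure d X \<mu>" "q \<in> X" "0 < d"
    and p: "0 < p" "p < p'"
    and r: "p \<le> measure \<mu> (cball q r)" "measure \<mu> (ball q r) \<le> p"
    and r': "p' \<le> measure \<mu> (cball q r')"
  shows "0 < r" and "0 < r'" and "r / r' \<le> 2 * (p / p') powr (1 / d)"
proof -
  interpret prob_space \<mu> by fact
  have sub: "measure \<mu> A \<le> measure \<mu> B" if "A \<subseteq> B" "B \<in> sets borel" for A B
    using that sets by (intro finite_measure_mono) auto
  \<comment> \<open>Absence of point masses enters here: a closed ball of radius at most 0 is a null
    set.\<close>
  have pos: "0 < u" if "0 < measure \<mu> (cball q u)" for u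
  proof (rule ccontr)
    assume "\<not> 0 < u"
    then have "cball q u \<subseteq> {q}"
      by (intro subsetI) (metis dist_le_zero_iff insertI1 mem_cball not_less order_trans)
    then have "measure \<mu> (cball q u) \<le> measure \<mu> {q}" by (rule sub) simp
    also have "\<dots> = 0"
      using assms(3) by (simp add: continuous_measure_def measure_def)
    finally show False using that by simp
  qed
  show "0 < r" using pos[of r] r p by linarith
  show "0 < r'" using pos[of r'] r' p by linarith
  have "r \<le> r'"
  proof (rule ccontr)
    assume "\<not> r \<le> r'"
    then have "measure \<mu> (cball q r') \<le> measure \<mu> (ball q r)" by (intro sub) auto
    then show False using r r' p by linarith
  qed
  define t where "t = (LEAST t. r' / 2 ^ t < r)"
  have "\<exists>t. r' / 2 ^ t < r"
    using real_arch_pow[of 2 "r' / r"] \<open>0 < r\<close> by (auto simp: field_simps)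
  then have t: "r' / 2 ^ t < r" unfolding t_def by (rule LeastI_ex)
  \<comment> \<open>Some halving takes place, so by minimality \<open>t - 1\<close> halvings do not
    suffice; this bounds \<open>2 ^ t\<close> from above.\<close>
  have "t \<noteq> 0" using t \<open>r \<le> r'\<close> by (intro notI) simp
  then have "\<not> r' / 2 ^ (t - 1) < r" unfolding t_def by (intro not_less_Least) simp
  moreover have "(2::real) ^ t = 2 * 2 ^ (t - 1)"
    using \<open>t \<noteq> 0\<close> by (simp flip: power_Suc)
  ultimately have t': "2 ^ t \<le> 2 * r' / r"
    using \<open>0 < r\<close> by (simp add: field_simps)
  have "p' \<le> measure \<mu> (cball q (2 ^ t * (r' / 2 ^ t)))" using r' by simp
  also have "\<dots> \<le> (2 powr d) ^ t * measure \<mu> (cball q (r' / 2 ^ t))"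
    by (rule doubling_measure_iterate[OF finite_measure_axioms assms(4,5)]) (use \<open>0 < r'\<close> in simp)
  also have "measure \<mu> (cball q (r' / 2 ^ t)) \<le> measure \<mu> (ball q r)"
    using t by (intro sub) auto
  also have "\<dots> \<le> p" by fact
  also have "(2 powr d) ^ t = (2 ^ t) powr d"
    by (simp add: powr_powr mult.commute flip: powr_realpow)
  also have "(2 ^ t) powr d \<le> (2 * r' / r) powr d"
    using t' \<open>0 < d\<close> by (intro powr_mono2) auto
  finally have "p' \<le> (2 * r' / r) powr d * p"
    using p by (simp add: mult_left_mono mult_right_mono)
  then have "p' / p \<le> (2 * r' / r) powr d" using p by (simp add: field_simps)
  then have "(p' / p) powr (1 / d) \<le> ((2 * r' / r) powr d) powr (1 / d)"
    using p \<open>0 < d\<close> by (intro powr_mono2) auto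
  also have "\<dots> = 2 * r' / r"
    using \<open>0 < d\<close> \<open>0 < r\<close> \<open>0 < r'\<close> by (simp add: powr_powr)
  finally have "(p' / p) powr (1 / d) \<le> 2 * r' / r" .
  then have "p' powr (1 / d) / p powr (1 / d) \<le> 2 * r' / r"
    using p by (simp add: powr_divide)
  then show "r / r' \<le> 2 * (p / p') powr (1 / d)"
    using p \<open>0 < r\<close> \<open>0 < r'\<close> by (simp add: powr_divide field_simps)
qed

section \<open>Union bound and the probabilistic estimate\<close>

text \<open>Split 7/12 = 1/12 + 1/2. Since
  \<open>ln (1 / \<delta>) \<le> K < i / 16 \<le> i / 12\<close>, the first part yields the factor
  \<open>\<delta>\<close>; the second leaves a geometric series with ratio at most 2/3.\<close>

lemma sum_exp_tail_le:
  assumes "0 < \<delta>" "ln (1 / \<delta>) \<le> K" and I: "I \<subseteq> {i. 16 * K < real i \<and> 1 \<le> i \<and> i \<le> n}"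
  shows "(\<Sum>i\<in>I. exp (- 7 / 12 * real i)) \<le> 2 * \<delta>"
proof -
  let ?y = "exp (- 1 / 2) :: real"
  have y: "?y \<le> 2 / 3"
  proof -
    have "3 / 2 \<le> exp (1 / 2 :: real)" using exp_ge_add_one_self[of "1 / 2 :: real"] by simp
    then show ?thesis by (simp add: exp_minus field_simps)
  qed
  have "(\<Sum>i\<in>I. exp (- 7 / 12 * real i)) \<le> (\<Sum>i\<in>I. \<delta> * ?y ^ i)"
  proof (rule sum_mono)
    fix i assume "i \<in> I"
    then have i: "16 * K < real i" "1 \<le> i" using I by auto
    have "exp (- 7 / 12 * real i) = exp (- real i / 12) * ?y ^ i"
      by (simp add: exp_of_nat_mult[symmetric] exp_add[symmetric])
    also have "exp (- real i / 12) \<le> exp (- ln (1 / \<delta>))"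
      using i assms(2) by simp
    also have "\<dots> = \<delta>" using \<open>0 < \<delta>\<close> by (simp add: exp_minus)
    finally show "exp (- 7 / 12 * real i) \<le> \<delta> * ?y ^ i" by (simp add: mult_right_mono)
  qed
  also have "\<dots> \<le> (\<Sum>i = 1..n. \<delta> * ?y ^ i)"
    using I \<open>0 < \<delta>\<close> by (intro sum_mono2) auto
  also have "\<dots> = \<delta> * (\<Sum>i = 1..n. ?y ^ i)" by (simp add: sum_distrib_left)
  also have "(\<Sum>i = 1..n. ?y ^ i) \<le> 2"
  proof -
    have "(\<Sum>i = 1..n. ?y ^ i) \<le> ?y / (1 - ?y)"
      using y by (auto simp: sum_gp intro!: divide_right_mono)
    also have "\<dots> \<le> 2" using y by (simp add: field_simps)
    finally show ?thesis .
  qed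
  finally show ?thesis using \<open>0 < \<delta>\<close> by (simp add: mult_left_mono mult.commute)
qed

theorem theorem9:
  fixes \<mu> :: "(real ^ 'd) measure"
    and X :: "(real ^ 'd) set"
    and q :: "real ^ 'd"
    and d\<^sub>o \<delta> :: real
    and n k :: nat
  assumes "prob_space \<mu>"
    and "sets \<mu> = sets borel"
    and "continuous_measure \<mu>"
    and "d\<^sub>o \<ge> 2"
    and "doubling_measure d\<^sub>o X \<mu>"
    and "q \<in> X"
    and "0 < \<delta>" and "\<delta> < 1/2"
    and "k \<ge> 1"
  shows "\<P>(x in (\<Pi>\<^sub>M i\<in>{1..n}. \<mu>).
            \<forall>m\<in>{2..n}. Phi k m q (map x [1..<n+1])
               \<le> 6 * (8 / real m * max (real k) (ln (1 / \<delta>))) powr (1 / d\<^sub>o))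
         \<ge> 1 - 3 * \<delta>"
proof -
  define K where "K = max (real k) (ln (1 / \<delta>))"
  define s where "s = 1 / d\<^sub>o"
  define C where "C = 16 * K"
  have K: "real k \<le> K" "ln (1 / \<delta>) \<le> K" "1 \<le> K"
    using assms(9) by (auto simp: K_def)
  have s: "0 \<le> s" "s \<le> 1 / 2" using assms(4) by (auto simp: s_def field_simps)
  let ?M = "\<Pi>\<^sub>M i\<in>{1..n}. \<mu>"
  interpret M: prob_space ?M using assms(1) by (intro prob_space_PiM)
  let ?D = "\<lambda>x i. dist q (nearest q (map x [1..<n+1]) i)"
  let ?E = "{x\<in>space ?M. \<forall>m\<in>{2..n}. Phi k m q (map x [1..<n+1]) \<le> 6 * (8 / real m * K) powr s}"
  \<comment> \<open>Needed at the end to pass from the complement back to \<open>?E\<close>.\<close>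
  have E: "?E \<in> sets ?M"
  proof (rule sets.sets_Collect_finite_All)
    fix m assume "m \<in> {2..n}"
    then have "(\<lambda>x. Phi k m q (map x [1..<n+1])) \<in> borel_measurable ?M"
      by (intro measurable_Phi assms(2)) simp
    then show "{x \<in> space ?M. Phi k m q (map x [1..<n+1]) \<le> 6 * (8 / real m * K) powr s} \<in> sets ?M"
      by measurable
  qed simp
  have inE: "x \<in> ?E" if x: "x \<in> space ?M"
    and ratio: "\<And>i. k < i \<Longrightarrow> i \<le> n \<Longrightarrow> C < real i \<Longrightarrow> ?D x k / ?D x i \<le> 2 * (C / real i) powr s" for x
  proof -
    have "Phi k m q (map x [1..<n+1]) \<le> 6 * (8 / real m * K) powr s" if m: "m \<in> {2..n}" for m
    proof -
      have "Phi k m q (map x [1..<n+1]) \<le> 4 * (C / real m) powr s"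
        using m K by (intro Phi_le ratio assms(9) s) (auto simp: C_def)
      \<comment> \<open>\<open>C\<close> is twice \<open>8 * K\<close>; the extra
        \<open>2 powr s\<close> is at most 3/2 and turns 4 into 6.\<close>
      also have "C / real m = 2 * (8 / real m * K)" by (simp add: C_def)
      also have "\<dots> powr s = 2 powr s * (8 / real m * K) powr s"
        by (rule powr_mult)
      also have "2 powr s \<le> 2 powr (1 / 2)" using s by (intro powr_mono) auto
      also have "\<dots> \<le> 3 / 2"
        unfolding powr_half_sqrt[of 2, simplified] by (rule real_le_lsqrt) (auto simp: power2_eq_square)
      finally show ?thesis by (simp add: mult_right_mono)
    qed
    then show ?thesis using x by simp
  qed
  have "1 - 3 * \<delta> \<le> M.prob ?E"
  proof (cases "real n \<le> C")
    case True
    \<comment> \<open>No \<open>i \<le> n\<close> exceeds \<open>C\<close>, so the ratio condition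
      is vacuous.\<close>
    have "?E = space ?M" using inE True by fastforce
    then show ?thesis using M.prob_space assms(7) by simp
  next
    case False
    then have n: "16 * K < real n" by (simp add: C_def)
    \<comment> \<open>With this mass the open ball of radius \<open>R i\<close> has expected count
      at most \<open>i / 4\<close>, as \<open>count_upper_tail\<close> requires.\<close>
    define p where "p i = real i / (4 * real n)" for i
    obtain r where r: "4 * K / real n \<le> measure \<mu> (cball q r)" "measure \<mu> (ball q r) \<le> 4 * K / real n"
      by (rule exists_quantile_radius[OF assms(1,2), of "4 * K / real n" q]) (use n K in \<open>auto simp: field_simps\<close>)
    have "\<forall>i. \<exists>u. 1 \<le> i \<longrightarrow> i \<le> n \<longrightarrow> p i \<le> measure \<mu> (cball q u) \<and> measure \<mu> (ball q u) \<le> p i"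
    proof
      fix i
      show "\<exists>u. 1 \<le> i \<longrightarrow> i \<le> n \<longrightarrow> p i \<le> measure \<mu> (cball q u) \<and> measure \<mu> (ball q u) \<le> p i"
      proof (cases "1 \<le> i \<and> i \<le> n")
        case True
        then have "0 < p i" "p i < 1" by (auto simp: p_def field_simps)
        from exists_quantile_radius[OF assms(1,2) this] show ?thesis by metis
      qed auto
    qed
    then obtain R where R: "p i \<le> measure \<mu> (cball q (R i))" "measure \<mu> (ball q (R i)) \<le> p i"
      if "1 \<le> i" "i \<le> n" for i by metis
    define I where "I = {i. 16 * K < real i \<and> 1 \<le> i \<and> i \<le> n}"
    have "finite I" by (auto simp: I_def)
    let ?A = "{x\<in>space ?M. card {j\<in>{1..n}. x j \<in> cball q r} < k}"
    let ?B = "\<lambda>i. {x\<in>space ?M. i \<le> card {j\<in>{1..n}. x j \<in> ball q (R i)}}"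
    have sets: "cball q u \<in> sets \<mu>" "ball q u \<in> sets \<mu>" for u using assms(2) by auto
    have A: "?A \<in> sets ?M" and B: "?B i \<in> sets ?M" for i
      using measurable_card_count[OF sets(1), of "{1..n}" r] measurable_card_count[OF sets(2), of "{1..n}" "R i"]
      by measurable
    have good: "x \<in> ?E" if x: "x \<in> space ?M" "x \<notin> ?A" "\<And>i. i \<in> I \<Longrightarrow> x \<notin> ?B i" for x
    proof (rule inE[OF x(1)])
      fix i assume i: "k < i" "i \<le> n" "C < real i"
      then have "i \<in> I" by (auto simp: I_def C_def)
      have "?D x k \<le> r"
        by (subst dist_nearest_iff[where P="\<lambda>a. a \<le> r"]) (use x i assms(9) in auto)
      moreover have "\<not> ?D x i < R i"
        by (subst dist_nearest_iff[where P="\<lambda>a. a < R i"]) (use x(1) x(3)[OF \<open>i \<in> I\<close>] i in auto)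
      \<comment> \<open>The condition \<open>4 * K / n < p i\<close> of the ratio lemma is exactly
        \<open>C < i\<close>.\<close>
      moreover have "0 < r" "0 < R i" "r / R i \<le> 2 * ((4 * K / real n) / p i) powr (1 / d\<^sub>o)"
        using doubling_quantile_ratio[OF assms(1-3,5,6) _ _ _ r R(1)[of i]] n K i assms(4)
        by (auto simp: p_def C_def field_simps)
      moreover have "(4 * K / real n) / p i = C / real i"
        using n K i by (simp add: p_def C_def)
      ultimately show "?D x k / ?D x i \<le> 2 * (C / real i) powr s"
        unfolding s_def using frac_le[of r "?D x k" "R i" "?D x i"] by simp
    qed
    \<comment> \<open>In this union bound \<open>?A\<close> contributes \<open>\<delta>\<close> and
      all the \<open>?B i\<close> together \<open>2 * \<delta>\<close>.\<close>
    have "M.prob (space ?M - ?E) \<le> M.prob (?A \<union> (\<Union>i\<in>I. ?B i))"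
    proof (rule M.finite_measure_mono)
      show "space ?M - ?E \<subseteq> ?A \<union> (\<Union>i\<in>I. ?B i)" using good by blast
      show "?A \<union> (\<Union>i\<in>I. ?B i) \<in> sets ?M"
        by (intro sets.Un sets.finite_UN A B \<open>finite I\<close>)
    qed
    also have "\<dots> \<le> M.prob ?A + M.prob (\<Union>i\<in>I. ?B i)"
      by (intro measure_Un_le sets.finite_UN A B \<open>finite I\<close>)
    also have "M.prob (\<Union>i\<in>I. ?B i) \<le> (\<Sum>i\<in>I. M.prob (?B i))"
      by (intro M.finite_measure_subadditive_finite image_subsetI B \<open>finite I\<close>)
    also have "\<dots> \<le> (\<Sum>i\<in>I. exp (- 7 / 12 * real i))"
    proof (intro sum_mono count_upper_tail assms(1) sets)
      fix i assume "i \<in> I"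
      then have i: "1 \<le> i" "i \<le> n" by (auto simp: I_def)
      then have "real n * measure \<mu> (ball q (R i)) \<le> real n * p i"
        using R(2) by (intro mult_left_mono) auto
      then show "real n * measure \<mu> (ball q (R i)) \<le> real i / 4"
        using i by (simp add: p_def)
    qed
    also have "\<dots> \<le> 2 * \<delta>"
      by (rule sum_exp_tail_le[OF assms(7) K(2), where n=n]) (simp add: I_def)
    also have "M.prob ?A \<le> exp (- K)"
      using n K r(1) by (intro count_lower_tail assms(1) sets) (auto simp: field_simps)
    also have "exp (- K) \<le> exp (- ln (1 / \<delta>))" using K(2) by simp
    also have "\<dots> = \<delta>" using assms(7) by (simp add: exp_minus)
    finally have "M.prob (space ?M - ?E) \<le> 3 * \<delta>" by simp
    then show ?thesis using M.prob_compl[OF E] by linarith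
  qed
  then show ?thesis unfolding K_def s_def .
qed

end
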